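(* Let $G=(V,E)$ be a graph of minimum degree $\delta\geq 2$ and maximum degree $\Delta$. Then $$\chi'_{\subset}(G)\leq 3\Delta-1.$$
   Context: All graphs are simple and finite. For an edge colouring $c\colon E\to C$ of a graph $G=(V,E)$, the palette of a vertex $v$ is $S_c(v)=\{c(uv): u\in N(v)\}$. The colouring $c$ is inclusion-free if it is proper (adjacent edges receive distinct colours) and for every edge $uv\in E$ we have $S_c(u)\not\subseteq S_c(v)$ and $S_c(v)\not\subseteq S_c(u)$. The inclusion chromatic index $\chi'_{\subset}(G)$ is the least number of colours in an inclusion-free colouring of $G$. *)

theory Defs
  imports Main "HOL-Library.Extended_Nat"
begin

locale fin_simple_graph =
  fixes V :: "'a set" and E :: "'a set set"
  assumes finite_V: "finite V"
    and edges: "e \<in> E \<Longrightarrow> e \<subseteq> V \<and> card e = 2"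

definition neighbours :: "'a set set \<Rightarrow> 'a \<Rightarrow> 'a set" where
  "neighbours E v = {u. {u, v} \<in> E}"

definition degree :: "'a set set \<Rightarrow> 'a \<Rightarrow> nat" where
  "degree E v = card (neighbours E v)"

definition min_degree :: "'a set \<Rightarrow> 'a set set \<Rightarrow> nat" where
  "min_degree V E = Min (degree E ` V)"

definition max_degree :: "'a set \<Rightarrow> 'a set set \<Rightarrow> nat" where
  "max_degree V E = Max (degree E ` V)"

definition palette :: "'a set set \<Rightarrow> ('a set \<Rightarrow> 'c) \<Rightarrow> 'a \<Rightarrow> 'c set" where
  "palette E c v = {c {u, v} | u. u \<in> neighbours E v}"

definition proper_edge_colouring :: "'a set set \<Rightarrow> ('a set \<Rightarrow> 'c) \<Rightarrow> bool" where
  "proper_edge_colouring E c \<longleftrightarrow>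
     (\<forall>e\<in>E. \<forall>f\<in>E. e \<noteq> f \<and> e \<inter> f \<noteq> {} \<longrightarrow> c e \<noteq> c f)"

definition inclusion_free :: "'a set set \<Rightarrow> ('a set \<Rightarrow> 'c) \<Rightarrow> bool" where
  "inclusion_free E c \<longleftrightarrow> proper_edge_colouring E c \<and>
     (\<forall>u v. {u, v} \<in> E \<longrightarrow>
        \<not> palette E c u \<subseteq> palette E c v \<and> \<not> palette E c v \<subseteq> palette E c u)"

text \<open>
  The index is \<open>\<infinity>\<close> if the graph has no inclusion-free colouring at all (for instance if it has
  a vertex of degree 1), so that a finite upper bound also asserts that such a colouring exists.
\<close>

definition inclusion_chromatic_index :: "'a set set \<Rightarrow> enat" where
  "inclusion_chromatic_index E =
     Inf {enat k | k. \<exists>c :: 'a set \<Rightarrow> nat. c ` E \<subseteq> {..<k} \<and> inclusion_free E c}"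

end

theory Submission
  imports Defs
begin

text \<open>
  Order the vertices by decreasing degree and colour the edges greedily, vertex by vertex, each
  vertex \<open>w\<close> colouring its edges to later vertices.  It suffices that \<open>S(w)\<close> is not contained in
  \<open>S(y)\<close> for every edge \<open>yw\<close> with \<open>y\<close> before \<open>w\<close>: since \<open>y\<close> has at least the degree of \<open>w\<close>, the
  other inclusion would force equality.  If \<open>y\<close> is followed by another earlier neighbour \<open>x\<close> of
  \<open>w\<close>, the palette of \<open>y\<close> is complete when \<open>xw\<close> is coloured, and the colour of \<open>xw\<close> can be taken
  outside it.  For the last earlier neighbour of \<open>w\<close> the same is done by the last edge that \<open>w\<close>
  colours.  Only a sink \<open>u\<close> (a vertex without later neighbours) has no such edge.  If \<open>x\<close> is its
  last neighbour, the first coloured edge at \<open>u\<close> gets a colour not yet present at \<open>x\<close>, and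
  afterwards no edge at \<open>x\<close> may take the only colour that still distinguishes \<open>u\<close> from \<open>x\<close>.
  Placing the sinks at the end of the order, every edge has at most \<open>3\<Delta> - 2\<close> forbidden colours.
\<close>

section \<open>Greedy choice and extremal elements\<close>

text \<open>By \<open>local\<close>, the constraint at \<open>e\<close> reads \<open>c\<close> only
  at strictly smaller ranks, so redefining \<open>c\<close> on one level disturbs neither the lower
  levels nor the constraints within that level.\<close>

lemma greedy_choice:
  fixes r :: "'e \<Rightarrow> nat" and ok :: "'e \<Rightarrow> ('e \<Rightarrow> 'c) \<Rightarrow> 'c \<Rightarrow> bool"
  assumes "finite A"
    and local: "\<And>e c c' a. e \<in> A \<Longrightarrow> (\<And>g. g \<in> A \<Longrightarrow> r g < r e \<Longrightarrow> c g = c' g) \<Longrightarrow> ok e c a = ok e c' a"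
    and ex: "\<And>e c. e \<in> A \<Longrightarrow> \<exists>a. ok e c a"
  obtains c where "\<And>e. e \<in> A \<Longrightarrow> ok e c (c e)"
proof -
  have step: "\<exists>c. \<forall>e\<in>A. r e < n \<longrightarrow> ok e c (c e)" for n
  proof (induction n)
    case 0
    then show ?case by simp
  next
    case (Suc n)
    then obtain c where c: "\<And>e. e \<in> A \<Longrightarrow> r e < n \<Longrightarrow> ok e c (c e)" by blast
    define c' where "c' e = (if r e = n then SOME a. ok e c a else c e)" for e
    have "ok e c' (c' e)" if e: "e \<in> A" "r e < Suc n" for e
    proof -
      have "ok e c' a = ok e c a" for a
        by (rule local) (use e in \<open>auto simp: c'_def\<close>)
      moreover have "ok e c (c' e)"
      proof (cases "r e = n")
        case True
        then show ?thesis using someI_ex[OF ex[OF e(1), of c]] by (simp add: c'_def)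
      next
        case False
        then show ?thesis using c e by (simp add: c'_def)
      qed
      ultimately show ?thesis by blast
    qed
    then show ?case by blast
  qed
  obtain n where n: "\<And>e. e \<in> A \<Longrightarrow> r e < n"
    using finite_nat_set_iff_bounded[of "r ` A"] assms(1) by auto
  with step[of n] that show thesis by blast
qed

lemma finite_ex_greatest:
  fixes f :: "'a \<Rightarrow> nat"
  assumes "finite A" "A \<noteq> {}"
  shows "\<exists>x\<in>A. \<forall>y\<in>A. f y \<le> f x"
proof -
  have "Max (f ` A) \<in> f ` A" using assms by simp
  then obtain x where "x \<in> A" "f x = Max (f ` A)" by auto
  then show ?thesis using assms by (metis Max_ge finite_imageI imageI)
qed

lemma finite_ex_least:
  fixes f :: "'a \<Rightarrow> nat"
  assumes "finite A" "A \<noteq> {}"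
  shows "\<exists>x\<in>A. \<forall>y\<in>A. f x \<le> f y"
proof -
  have "Min (f ` A) \<in> f ` A" using assms by simp
  then obtain x where "x \<in> A" "f x = Min (f ` A)" by auto
  then show ?thesis using assms by (metis Min_le finite_imageI imageI)
qed

lemma card_singleton_Collect_le: "finite {a. A = {a}} \<and> card {a. A = {a}} \<le> 1"
proof (cases "\<exists>a. A = {a}")
  case True
  then obtain a where "A = {a}" by blast
  then have "{a. A = {a}} = {a}" by auto
  then show ?thesis by simp
qed simp

section \<open>Vertex orders, edge ranks and forbidden colours\<close>

text \<open>Edges are thought of as oriented towards larger \<open>f\<close>. The bound
  \<open>M\<close> is the base in which \<open>rank\<close> encodes the two endpoints of an edge as
  one number.\<close>

locale ordered_graph = fin_simple_graph V E
  for V :: "'a set" and E :: "'a set set" +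
  fixes f :: "'a \<Rightarrow> nat" and M D :: nat
  assumes inj_f: "inj_on f V"
    and f_less: "v \<in> V \<Longrightarrow> f v < M"
    and degree_ge_2: "v \<in> V \<Longrightarrow> 2 \<le> degree E v"
    and degree_le: "v \<in> V \<Longrightarrow> degree E v \<le> D"
    and degree_decreasing: "{x, w} \<in> E \<Longrightarrow> f x < f w \<Longrightarrow> degree E w \<le> degree E x"
    and sinks_last: "v \<in> V \<Longrightarrow> \<forall>t\<in>neighbours E v. f t < f v \<Longrightarrow>
          {w, t} \<in> E \<Longrightarrow> f w < f t \<Longrightarrow> f w < f v"
begin

abbreviation N :: "'a \<Rightarrow> 'a set" where "N \<equiv> neighbours E"

definition sink :: "'a \<Rightarrow> bool" where
  "sink v \<longleftrightarrow> (\<forall>t\<in>N v. f t < f v)"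

text \<open>Compares edges lexicographically, first by the earlier endpoint.\<close>

definition rank :: "'a set \<Rightarrow> nat" where
  "rank e = Min (f ` e) * M + Max (f ` e)"

text \<open>The threshold \<open>m\<close> is \<open>f w\<close> when \<open>v\<close> is the later
  endpoint of an edge to \<open>w\<close>, and \<open>f v\<close> when all earlier neighbours of
  \<open>v\<close> compete.\<close>

definition is_pred :: "'a \<Rightarrow> nat \<Rightarrow> 'a \<Rightarrow> bool" where
  "is_pred v m y \<longleftrightarrow> y \<in> N v \<and> f y < m \<and> (\<forall>t\<in>N v. f t < m \<longrightarrow> f t \<le> f y)"

text \<open>These are the sinks whose palettes must not be swallowed by that of \<open>x\<close>
  while edges at \<open>x\<close> are coloured.\<close>

definition sinks_at :: "'a \<Rightarrow> 'a set" where
  "sinks_at x = {u \<in> N x. sink u \<and> is_pred u (f u) x}"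

definition seen :: "('a set \<Rightarrow> nat) \<Rightarrow> nat \<Rightarrow> 'a \<Rightarrow> nat set" where
  "seen c j v = {c {t, v} | t. t \<in> N v \<and> rank {t, v} < j}"

text \<open>The predecessor matters only while no colour at \<open>v\<close> separates the two. In
  that case its colours include those of \<open>v\<close>, so the union costs no more than one
  palette.\<close>

definition blocked :: "('a set \<Rightarrow> nat) \<Rightarrow> nat \<Rightarrow> 'a \<Rightarrow> nat \<Rightarrow> nat set" where
  "blocked c j v m = seen c j v \<union> \<Union> {seen c j y | y. is_pred v m y \<and> seen c j v \<subseteq> seen c j y}"

text \<open>Each sink contributes at most one colour, its sole remaining separator from
  \<open>v\<close>. The other endpoint \<open>z\<close> of the edge being coloured can be left out,
  because the new colour avoids everything seen at \<open>z\<close> anyway.\<close>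

definition guarded :: "('a set \<Rightarrow> nat) \<Rightarrow> nat \<Rightarrow> 'a \<Rightarrow> 'a \<Rightarrow> nat set" where
  "guarded c j v z = (\<Union>u\<in>sinks_at v - {z}. {a. seen c j u - seen c j v = {a}})"

text \<open>Here \<open>w\<close> is the earlier endpoint. Besides properness, the first set
  separates \<open>z\<close> from its neighbour preceding \<open>w\<close>, the second separates
  \<open>w\<close> from its last earlier neighbour, the third starts the separation of a sink from
  its last neighbour, and the guarded sets preserve such separations.\<close>

definition forbidden :: "('a set \<Rightarrow> nat) \<Rightarrow> 'a \<Rightarrow> 'a \<Rightarrow> nat set" where
  "forbidden c w z = (let j = rank {w, z} in
     blocked c j z (f w)
     \<union> (if \<forall>t\<in>N w. f t \<le> f z then blocked c j w (f w) else seen c j w)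
     \<union> (if \<exists>y. is_pred z (f w) y then {} else \<Union> {seen c j x | x. sink z \<and> is_pred z (f z) x})
     \<union> guarded c j w z \<union> guarded c j z w)"

lemma N_sym: "u \<in> N v \<longleftrightarrow> v \<in> N u"
  by (simp add: neighbours_def insert_commute)

lemma N_D:
  assumes "u \<in> N v"
  shows "{u, v} \<in> E" "{v, u} \<in> E" "u \<in> V" "v \<in> V" "u \<noteq> v" "f u \<noteq> f v"
proof -
  show E: "{u, v} \<in> E" "{v, u} \<in> E" using assms by (auto simp: neighbours_def insert_commute)
  show V: "u \<in> V" "v \<in> V" using edges[OF E(1)] by auto
  show "u \<noteq> v" using edges[OF E(1)] by auto
  then show "f u \<noteq> f v" using V inj_f by (auto dest: inj_onD)
qed

lemma finite_N: "finite (N v)"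
  by (rule finite_subset[OF _ finite_V]) (use N_D in blast)

lemma finite_E: "finite E"
  by (rule finite_subset[of _ "Pow V"]) (use edges finite_V in auto)

lemma card_N_le: "v \<in> V \<Longrightarrow> card (N v) \<le> D"
  using degree_le by (simp add: degree_def)

lemma edge_cases:
  assumes "e \<in> E"
  obtains w z where "e = {w, z}" "f w < f z" "z \<in> N w" "w \<in> N z"
proof -
  obtain u v where uv: "e = {u, v}" "u \<noteq> v"
    using edges[OF assms] by (auto simp: card_2_iff)
  then have n: "u \<in> N v" "v \<in> N u" using assms by (auto simp: neighbours_def insert_commute)
  show thesis
    using that[of u v] that[of v u] uv n N_D(6)[OF n(1)] by (auto simp: insert_commute neq_iff)
qed

lemma rank_eq: "f w < f z \<Longrightarrow> rank {w, z} = f w * M + f z"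
  by (simp add: rank_def min_def max_def)

text \<open>As \<open>f\<close> stays below \<open>M\<close>, a rank is a two-digit number in base
  \<open>M\<close>.\<close>

lemma rank_less_iff:
  assumes "z \<in> N w" "f w < f z" "t \<in> N s" "f s < f t"
  shows "rank {w, z} < rank {s, t} \<longleftrightarrow> f w < f s \<or> f w = f s \<and> f z < f t"
proof -
  have M: "f z < M" "f t < M" using f_less N_D assms by blast+
  have *: "a * M + b < c * M + d" if "a < c" "b < M" for a b c d :: nat
  proof -
    have "Suc a * M \<le> c * M" using that by (intro mult_right_mono) auto
    then show ?thesis using that by simp
  qed
  show ?thesis
    using *[of "f w" "f s" "f z" "f t"] *[of "f s" "f w" "f t" "f z"] M assms
    by (auto simp: rank_eq not_less_iff_gr_or_eq)
qed

lemma rank_inj: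
  assumes "e \<in> E" "g \<in> E" "rank e = rank g"
  shows "e = g"
proof -
  obtain w z where e: "e = {w, z}" "f w < f z" "z \<in> N w" using assms edge_cases by metis
  obtain s t where g: "g = {s, t}" "f s < f t" "t \<in> N s" using assms edge_cases by metis
  have "f w = f s" "f z = f t"
    using rank_less_iff[of z w t s] rank_less_iff[of t s z w] e g assms(3) by auto
  then have "w = s" "z = t" using inj_f N_D[OF e(3)] N_D[OF g(3)] by (auto dest: inj_onD)
  then show ?thesis using e g by simp
qed

lemma is_pred_unique: "is_pred v m y \<Longrightarrow> is_pred v m y' \<Longrightarrow> y = y'"
  using inj_f N_D(3) unfolding is_pred_def by (meson inj_onD le_antisym)

lemma ex_is_pred:
  assumes "t \<in> N v" "f t < m"
  shows "\<exists>y. is_pred v m y"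
  using finite_ex_greatest[of "{t \<in> N v. f t < m}" f] finite_N[of v] assms
  by (auto simp: is_pred_def)

lemma sinks_at_props:
  assumes "u \<in> sinks_at x"
  shows "u \<in> N x" "sink u" "f x < f u"
  using assms by (auto simp: sinks_at_def is_pred_def)

lemma finite_sinks_at: "finite (sinks_at x)"
  by (rule finite_subset[OF _ finite_N[of x]]) (auto simp: sinks_at_def)

lemma seen_image: "seen c j v = (\<lambda>t. c {t, v}) ` {t \<in> N v. rank {t, v} < j}"
  by (auto simp: seen_def)

lemma finite_seen: "finite (seen c j v)"
  unfolding seen_image using finite_N by auto

lemma card_seen_le: "card (seen c j v) \<le> card {t \<in> N v. rank {t, v} < j}"
  unfolding seen_image by (rule card_image_le) (use finite_N in auto)

lemma card_seen_le_D:
  assumes "v \<in> V"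
  shows "card (seen c j v) \<le> D"
proof -
  have "card {t \<in> N v. rank {t, v} < j} \<le> card (N v)"
    by (rule card_mono) (use finite_N in auto)
  then show ?thesis using card_seen_le[of c j v] card_N_le[OF assms] by linarith
qed

lemma seen_cong:
  assumes "\<And>g. g \<in> E \<Longrightarrow> rank g < j \<Longrightarrow> c g = c' g"
  shows "seen c j v = seen c' j v"
  unfolding seen_image by (rule image_cong) (use assms N_D in auto)

text \<open>Supplies the locality that \<open>greedy_choice\<close> requires.\<close>

lemma forbidden_cong:
  assumes "\<And>g. g \<in> E \<Longrightarrow> rank g < rank {w, z} \<Longrightarrow> c g = c' g"
  shows "forbidden c w z = forbidden c' w z"
proof -
  have "seen c (rank {w, z}) = seen c' (rank {w, z})"
    by (intro ext seen_cong assms)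
  then show ?thesis by (simp only: forbidden_def blocked_def guarded_def Let_def)
qed

section \<open>Counting forbidden colours\<close>

text \<open>Uniqueness of the predecessor collapses \<open>blocked\<close> to a single
  \<open>seen\<close> set, either that of \<open>v\<close> or that of the predecessor.\<close>

lemma finite_blocked: "finite (blocked c j v m)"
  and card_blocked: "v \<in> V \<Longrightarrow> card (blocked c j v m) \<le> D"
  and blocked_no_pred: "\<nexists>y. is_pred v m y \<Longrightarrow> blocked c j v m = seen c j v"
proof -
  show "\<nexists>y. is_pred v m y \<Longrightarrow> blocked c j v m = seen c j v"
    by (auto simp: blocked_def)
  have *: "(\<exists>y\<in>V. blocked c j v m = seen c j y) \<or> blocked c j v m = seen c j v"
  proof (cases "\<exists>y. is_pred v m y \<and> seen c j v \<subseteq> seen c j y")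
    case True
    then obtain y where y: "is_pred v m y" "seen c j v \<subseteq> seen c j y" by blast
    have "{seen c j y | y. is_pred v m y \<and> seen c j v \<subseteq> seen c j y} = {seen c j y}"
      using y is_pred_unique by blast
    then have "blocked c j v m = seen c j y" using y(2) by (auto simp: blocked_def)
    moreover have "y \<in> V" using y(1) N_D by (auto simp: is_pred_def)
    ultimately show ?thesis by blast
  next
    case False
    then show ?thesis by (auto simp: blocked_def)
  qed
  then show "finite (blocked c j v m)" using finite_seen by fastforce
  show "card (blocked c j v m) \<le> D" if "v \<in> V" using * card_seen_le_D that by metis
qed

lemma finite_guarded: "finite (guarded c j v z)"
  unfolding guarded_def using finite_sinks_at card_singleton_Collect_le by blast

lemma card_guarded: "card (guarded c j v z) \<le> card (sinks_at v - {z})"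
proof -
  have "card (guarded c j v z) \<le> (\<Sum>u\<in>sinks_at v - {z}. card {a. seen c j u - seen c j v = {a}})"
    unfolding guarded_def by (rule card_UN_le) (use finite_sinks_at in auto)
  also have "\<dots> \<le> (\<Sum>u\<in>sinks_at v - {z}. 1)"
    by (rule sum_mono) (use card_singleton_Collect_le in blast)
  finally show ?thesis by simp
qed

lemma seen_earlier_endpoint:
  assumes "z \<in> N w" "f w < f z"
  shows "{t \<in> N w. rank {t, w} < rank {w, z}} \<subseteq> {t \<in> N w. f t < f z}"
proof safe
  fix t assume t: "t \<in> N w" "rank {t, w} < rank {w, z}"
  show "f t < f z"
  proof (cases "f t < f w")
    case False
    then have "f w < f t" using N_D(6)[OF t(1)] by simp
    then show ?thesis using t rank_less_iff[of t w z w] assms by (simp add: insert_commute)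
  qed (use assms in simp)
qed

text \<open>An edge from \<open>z\<close> to a later vertex has first coordinate \<open>f z\<close>,
  which exceeds \<open>f w\<close>, so its turn has not come yet.\<close>

lemma seen_later_endpoint:
  assumes "z \<in> N w" "f w < f z"
  shows "{t \<in> N z. rank {t, z} < rank {w, z}} \<subseteq> {t \<in> N z. f t < f w}"
proof safe
  fix t assume t: "t \<in> N z" "rank {t, z} < rank {w, z}"
  show "f t < f w"
  proof (cases "f t < f z")
    case True
    then show ?thesis using t rank_less_iff[of z t z w] assms N_sym by auto
  next
    case False
    then have "f z < f t" using N_D(6)[OF t(1)] by simp
    then show ?thesis using t rank_less_iff[of t z z w] assms by (simp add: insert_commute)
  qed
qed

text \<open>Puts the sinks at the end of every neighbourhood. For a nonsink \<open>z\<close>, the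
  edges of \<open>w\<close> coloured before \<open>{w, z}\<close> and the sinks guarded at
  \<open>w\<close> then involve disjoint sets of neighbours.\<close>

lemma nonsink_before_sink:
  assumes "sink u" "u \<in> N w" "z \<in> N w" "\<not> sink z"
  shows "f z < f u"
proof -
  obtain t where "t \<in> N z" "f z < f t"
    using assms(4) N_D(6) by (fastforce simp: sink_def not_less_iff_gr_or_eq)
  then show ?thesis
    using sinks_last[of u z t] assms N_D by (auto simp: sink_def)
qed

text \<open>Nothing is guarded at a sink. The endpoint \<open>z\<close> costs at most
  \<open>D\<close> colours and \<open>w\<close> at most \<open>2 * D - 2\<close>.\<close>

lemma card_forbidden_sink:
  assumes z: "z \<in> N w" "f w < f z" and "sink z"
  shows "finite (forbidden c w z) \<and> card (forbidden c w z) \<le> 3 * D - 2"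
proof -
  define j where "j = rank {w, z}"
  define W where "W = (if \<forall>t\<in>N w. f t \<le> f z then blocked c j w (f w) else seen c j w)"
  define X where "X = (if \<exists>y. is_pred z (f w) y then {}
    else \<Union> {seen c j x | x. sink z \<and> is_pred z (f z) x})"
  have V: "w \<in> V" "z \<in> V" "w \<in> N z" using N_D[OF z(1)] z N_sym by auto
  have D2: "2 \<le> D" using degree_ge_2 degree_le V by force
  have "sinks_at z = {}"
    using \<open>sink z\<close> sinks_at_props[of _ z] by (force simp: sink_def)
  then have forb: "forbidden c w z = (blocked c j z (f w) \<union> X) \<union> (W \<union> guarded c j w z)"
    unfolding forbidden_def Let_def W_def X_def j_def by (auto simp: guarded_def)
  \<comment> \<open>The two sets are never both nonempty: \<open>X\<close> counts only for the first
    edge at \<open>z\<close>, when nothing is blocked there.\<close>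
  have zside: "finite (blocked c j z (f w) \<union> X) \<and> card (blocked c j z (f w) \<union> X) \<le> D"
  proof (cases "\<exists>y. is_pred z (f w) y")
    case True
    then show ?thesis using finite_blocked card_blocked V by (simp add: X_def)
  next
    case False
    then have "{t \<in> N z. f t < f w} = {}" using ex_is_pred by blast
    then have "seen c j z = {}"
      using seen_later_endpoint[OF z] unfolding seen_image j_def by blast
    then have b: "blocked c j z (f w) = {}" using blocked_no_pred False by simp
    obtain x where x: "is_pred z (f z) x" using ex_is_pred V z by blast
    then have "{seen c j x | x. sink z \<and> is_pred z (f z) x} = {seen c j x}"
      using is_pred_unique \<open>sink z\<close> by blast
    then have "X = seen c j x" using False by (simp add: X_def)
    moreover have "x \<in> V" using x N_D by (auto simp: is_pred_def)
    ultimately show ?thesis using b finite_seen card_seen_le_D by simp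
  qed
  have fin: "finite W" using finite_blocked finite_seen by (simp add: W_def)
  have wside: "card W + card (guarded c j w z) \<le> 2 * D - 2"
  proof (cases "\<exists>y. is_pred w (f w) y")
    case True
    then obtain y where y: "y \<in> N w" "f y < f w" by (auto simp: is_pred_def)
    \<comment> \<open>Guarded sinks come after \<open>w\<close>, so the earlier neighbour
      \<open>y\<close> is lost as well as \<open>z\<close>. This pays for a \<open>W\<close> of full
      size \<open>D\<close>.\<close>
    have "sinks_at w - {z} \<subseteq> N w - {z, y}"
      using sinks_at_props[of _ w] y by force
    then have "card (sinks_at w - {z}) \<le> card (N w - {z, y})"
      using finite_N by (intro card_mono) auto
    also have "\<dots> = card (N w) - 2"
      using y z finite_N by (subst card_Diff_subset) (auto simp: card_insert_if)
    finally have "card (guarded c j w z) \<le> D - 2"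
      using card_guarded[of c j w z] card_N_le[OF V(1)] by linarith
    moreover have "card W \<le> D" using card_blocked card_seen_le_D V by (simp add: W_def)
    ultimately show ?thesis using D2 by linarith
  next
    case False
    have c: "card (N w - {z}) \<le> D - 1"
      using z finite_N card_N_le[OF V(1)] by (simp add: card_Diff_singleton)
    have W: "W = seen c j w" using blocked_no_pred False by (simp add: W_def)
    have "card {t \<in> N w. rank {t, w} < j} \<le> card (N w - {z})"
      using seen_earlier_endpoint[OF z] finite_N by (intro card_mono) (auto simp: j_def)
    moreover have "card (sinks_at w - {z}) \<le> card (N w - {z})"
      using finite_N sinks_at_props by (intro card_mono) auto
    ultimately show ?thesis
      using c card_seen_le[of c j w] card_guarded[of c j w z] unfolding W by linarith
  qed
  have "card (forbidden c w z) \<le> D + (2 * D - 2)"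
    unfolding forb using zside wside card_Un_le[of W "guarded c j w z"]
      card_Un_le[of "blocked c j z (f w) \<union> X" "W \<union> guarded c j w z"] by linarith
  then show ?thesis
    using D2 zside fin finite_guarded unfolding forb by auto
qed

text \<open>The costs are exchanged: now \<open>w\<close> accounts for at most \<open>D\<close>
  colours and \<open>z\<close> for at most \<open>2 * D - 2\<close>.\<close>

lemma card_forbidden_nonsink:
  assumes z: "z \<in> N w" "f w < f z" and ns: "\<not> sink z"
  shows "finite (forbidden c w z) \<and> card (forbidden c w z) \<le> 3 * D - 2"
proof -
  define j where "j = rank {w, z}"
  define W where "W = (if \<forall>t\<in>N w. f t \<le> f z then blocked c j w (f w) else seen c j w)"
  have V: "w \<in> V" "z \<in> V" "w \<in> N z" using N_D[OF z(1)] z N_sym by auto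
  have D2: "2 \<le> D" using degree_ge_2 degree_le V by force
  have forb: "forbidden c w z =
      (blocked c j z (f w) \<union> guarded c j z w) \<union> (W \<union> guarded c j w z)"
    unfolding forbidden_def Let_def W_def j_def using ns by auto
  have later: "f z < f u" if "u \<in> sinks_at w" for u
    using nonsink_before_sink ns z sinks_at_props[OF that] by blast
  have fin: "finite W" using finite_blocked finite_seen by (simp add: W_def)
  have wside: "card W + card (guarded c j w z) \<le> D"
  proof (cases "\<forall>t\<in>N w. f t \<le> f z")
    case True
    then have "sinks_at w = {}" using later sinks_at_props(1) by fastforce
    then have "guarded c j w z = {}" by (simp add: guarded_def)
    then show ?thesis using True card_blocked V by (simp add: W_def)
  next
    case False
    then have W: "W = seen c j w" by (simp only: W_def if_False)
    have "card {t \<in> N w. rank {t, w} < j} \<le> card {t \<in> N w. f t < f z}"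
      using seen_earlier_endpoint[OF z] finite_N by (intro card_mono) (auto simp: j_def)
    moreover have "card (sinks_at w - {z}) \<le> card {t \<in> N w. f z < f t}"
      using finite_N sinks_at_props later by (intro card_mono) auto
    moreover have "card {t \<in> N w. f t < f z} + card {t \<in> N w. f z < f t}
        = card ({t \<in> N w. f t < f z} \<union> {t \<in> N w. f z < f t})"
      using finite_N by (intro card_Un_disjoint[symmetric]) auto
    moreover have "\<dots> \<le> card (N w)"
      using finite_N by (intro card_mono) auto
    ultimately show ?thesis
      using card_seen_le[of c j w] card_guarded[of c j w z] card_N_le[OF V(1)]
      unfolding W by linarith
  qed
  have zside: "card (blocked c j z (f w)) + card (guarded c j z w) \<le> 2 * D - 2"
  proof (cases "\<exists>y. is_pred z (f w) y")
    case True
    then obtain y where y: "y \<in> N z" "f y < f w" by (auto simp: is_pred_def)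
    have "sinks_at z - {w} \<subseteq> N z - {w, y}"
      using sinks_at_props[of _ z] y z by force
    then have "card (sinks_at z - {w}) \<le> card (N z - {w, y})"
      using finite_N by (intro card_mono) auto
    also have "\<dots> = card (N z) - 2"
      using y V finite_N by (subst card_Diff_subset) (auto simp: card_insert_if)
    finally have "card (guarded c j z w) \<le> D - 2"
      using card_guarded[of c j z w] card_N_le[OF V(2)] by linarith
    then show ?thesis using D2 card_blocked[OF V(2), of c j "f w"] by linarith
  next
    case False
    then have "{t \<in> N z. f t < f w} = {}" using ex_is_pred by blast
    then have "seen c j z = {}"
      using seen_later_endpoint[OF z] unfolding seen_image j_def by blast
    then have "blocked c j z (f w) = {}" using blocked_no_pred False by simp
    moreover have "card (sinks_at z - {w}) \<le> card (N z - {w})"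
      using finite_N sinks_at_props by (intro card_mono) auto
    moreover have "card (N z - {w}) \<le> D - 1"
      using V finite_N card_N_le[OF V(2)] by (simp add: card_Diff_singleton)
    ultimately show ?thesis using card_guarded[of c j z w] by simp
  qed
  have "card (forbidden c w z) \<le> (2 * D - 2) + D"
    unfolding forb using zside wside card_Un_le[of W "guarded c j w z"]
      card_Un_le[of "blocked c j z (f w)" "guarded c j z w"]
      card_Un_le[of "blocked c j z (f w) \<union> guarded c j z w" "W \<union> guarded c j w z"] by linarith
  then show ?thesis
    using D2 fin finite_blocked finite_guarded unfolding forb by auto
qed

definition admissible :: "('a set \<Rightarrow> nat) \<Rightarrow> bool" where
  "admissible c \<longleftrightarrow> (\<forall>w z. z \<in> N w \<and> f w < f z \<longrightarrow> c {w, z} \<notin> forbidden c w z)"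

text \<open>At most \<open>3 * D - 2\<close> colours are excluded at each edge, so one colour is
  always left.\<close>

lemma ex_admissible: "\<exists>c. admissible c \<and> c ` E \<subseteq> {..<3 * D - 1}"
proof -
  define ok where "ok e c a \<longleftrightarrow> a < 3 * D - 1 \<and>
    (\<forall>w z. e = {w, z} \<and> f w < f z \<longrightarrow> a \<notin> forbidden c w z)" for e c and a :: nat
  obtain c where c: "\<And>e. e \<in> E \<Longrightarrow> ok e c (c e)"
  proof (rule greedy_choice[of E rank ok, OF finite_E])
    fix e a and c c' :: "'a set \<Rightarrow> nat"
    assume "\<And>g. g \<in> E \<Longrightarrow> rank g < rank e \<Longrightarrow> c g = c' g"
    then show "ok e c a = ok e c' a"
      unfolding ok_def using forbidden_cong by metis
  next
    fix e and c :: "'a set \<Rightarrow> nat" assume "e \<in> E"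
    then obtain w z where e: "e = {w, z}" "f w < f z" "z \<in> N w" using edge_cases by metis
    have D2: "2 \<le> D" using degree_ge_2 degree_le N_D[OF e(3)] by force
    have "finite (forbidden c w z) \<and> card (forbidden c w z) < card {..<3 * D - 1}"
      using card_forbidden_sink[OF e(3,2), of c] card_forbidden_nonsink[OF e(3,2), of c] D2
      by fastforce
    then obtain a where "a \<in> {..<3 * D - 1} - forbidden c w z"
      by (metis Diff_eq_empty_iff card_mono ex_in_conv leD)
    \<comment> \<open>The order fixes which endpoint is first, so \<open>ok\<close> imposes a single
      forbidden set on \<open>e\<close>.\<close>
    moreover have "w' = w \<and> z' = z" if "e = {w', z'}" "f w' < f z'" for w' z'
      using that e by (auto simp: doubleton_eq_iff)
    ultimately show "\<exists>a. ok e c a" unfolding ok_def by blast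
  qed blast
  have "admissible c"
    unfolding admissible_def using c N_D(2) unfolding ok_def by blast
  moreover have "c ` E \<subseteq> {..<3 * D - 1}" using c by (auto simp: ok_def)
  ultimately show ?thesis by blast
qed

section \<open>Admissible colourings are inclusion-free\<close>

lemma seen_I:
  assumes "g \<in> E" "v \<in> g" "rank g < j"
  shows "c g \<in> seen c j v"
proof -
  obtain w z where "g = {w, z}" "z \<in> N w" "w \<in> N z" using edge_cases assms by metis
  then show ?thesis using assms by (auto simp: seen_def insert_commute)
qed

lemma seen_D:
  assumes "a \<in> seen c j v"
  shows "\<exists>g\<in>E. v \<in> g \<and> rank g < j \<and> a = c g"
proof -
  obtain t where "t \<in> N v" "rank {t, v} < j" "a = c {t, v}" using assms by (auto simp: seen_def)
  then show ?thesis using N_D(1) by blast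
qed

lemma seen_subset_palette: "seen c j v \<subseteq> palette E c v"
  by (auto simp: seen_def palette_def)

lemma admissible_not_seen:
  assumes "admissible c" "e \<in> E" "v \<in> e"
  shows "c e \<notin> seen c (rank e) v"
proof -
  obtain w z where e: "e = {w, z}" "z \<in> N w" "f w < f z" using edge_cases assms by metis
  then have "c e \<notin> forbidden c w z" using assms by (simp add: admissible_def)
  then show ?thesis
    using e assms(3) by (auto simp: forbidden_def Let_def blocked_def split: if_splits)
qed

lemma admissible_proper:
  assumes "admissible c"
  shows "proper_edge_colouring E c"
  unfolding proper_edge_colouring_def
proof (intro ballI impI)
  fix e g assume eg: "e \<in> E" "g \<in> E" "e \<noteq> g \<and> e \<inter> g \<noteq> {}"
  then obtain v where "v \<in> e" "v \<in> g" by blast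
  moreover have "rank e \<noteq> rank g" using eg rank_inj by blast
  ultimately show "c e \<noteq> c g"
    using admissible_not_seen[OF assms] seen_I eg by (metis linorder_neqE_nat)
qed

text \<open>Every edge at \<open>y\<close> has its earlier endpoint no later than \<open>y\<close>,
  hence before \<open>w\<close>, so it precedes \<open>{w, z}\<close>.\<close>

lemma seen_eq_palette:
  assumes "z \<in> N w" "f w < f z" "f y < f w"
  shows "seen c (rank {w, z}) y = palette E c y"
proof -
  have "rank {t, y} < rank {w, z}" if t: "t \<in> N y" for t
  proof (cases "f t < f y")
    case True
    then show ?thesis using rank_less_iff[of y t z w] t assms N_sym by auto
  next
    case False
    then have "f y < f t" using N_D(6)[OF t] by simp
    then show ?thesis using rank_less_iff[of t y z w] t assms by (auto simp: insert_commute)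
  qed
  then show ?thesis by (auto simp: seen_def palette_def)
qed

text \<open>Either a colour already seen at \<open>v\<close> separates it from \<open>y\<close>, or
  the whole palette of \<open>y\<close> is blocked and \<open>a\<close> separates.\<close>

lemma not_blocked_separates:
  assumes "is_pred v m y" "a \<notin> blocked c j v m" "a \<in> palette E c v" "seen c j y = palette E c y"
  shows "\<not> palette E c v \<subseteq> palette E c y"
  using assms seen_subset_palette[of c j v] unfolding blocked_def by blast

text \<open>The first edge \<open>{y, u}\<close> at the sink creates the separation, which is then
  an invariant through all later ranks. Degree at least 2 ensures that \<open>y\<close> differs from
  the last neighbour \<open>x\<close>.\<close>

lemma sink_separated:
  assumes adm: "admissible c" and u: "u \<in> V" "sink u" and x: "is_pred u (f u) x"
  shows "\<not> palette E c u \<subseteq> palette E c x"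
proof -
  have xu: "x \<in> N u" "f x < f u" using x by (auto simp: is_pred_def)
  have "2 \<le> card (N u)" using degree_ge_2[OF u(1)] by (simp add: degree_def)
  then have "\<not> N u \<subseteq> {x}" using card_mono[of "{x}" "N u"] by auto
  then obtain t where t: "t \<in> N u" "t \<noteq> x" by blast
  obtain y where y: "y \<in> N u" "\<And>t. t \<in> N u \<Longrightarrow> f y \<le> f t"
    using finite_ex_least[of "N u" f] finite_N t by blast
  have yu: "f y < f u" "u \<in> N y" using y(1) u(2) N_sym by (auto simp: sink_def)
  have "f t < f x"
    using t x u(2) inj_f N_D(3) unfolding is_pred_def sink_def
    by (metis inj_onD le_neq_implies_less)
  then have "y \<noteq> x" using y(2)[OF t(1)] by auto
  have "u \<in> sinks_at x" using xu u x N_sym by (auto simp: sinks_at_def)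
  have no_pred: "\<nexists>v. is_pred u (f y) v"
    using y(2) by (force simp: is_pred_def)
  have main: "\<not> seen c (Suc (rank {y, u}) + n) u \<subseteq> seen c (Suc (rank {y, u}) + n) x" for n
  proof (induction n)
    case 0
    let ?j = "rank {y, u}"
    have yE: "{y, u} \<in> E" using N_D y(1) by blast
    have "c {y, u} \<notin> forbidden c y u" using adm yu by (simp add: admissible_def)
    then have "c {y, u} \<notin> seen c ?j x"
      using no_pred u(2) x by (auto simp: forbidden_def Let_def)
    \<comment> \<open>The only edge of this rank is \<open>{y, u}\<close>, which misses
      \<open>x\<close>.\<close>
    moreover have "seen c (Suc ?j) x \<subseteq> seen c ?j x"
    proof
      fix a assume "a \<in> seen c (Suc ?j) x"
      then obtain g where g: "g \<in> E" "x \<in> g" "rank g < Suc ?j" "a = c g" using seen_D by blast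
      then have "g \<noteq> {y, u}" using \<open>y \<noteq> x\<close> xu by auto
      then have "rank g < ?j" using rank_inj[OF g(1) yE] g(3) by linarith
      then show "a \<in> seen c ?j x" using g seen_I by blast
    qed
    moreover have "c {y, u} \<in> seen c (Suc ?j) u" by (rule seen_I[OF yE]) auto
    ultimately show ?case by auto
  next
    case (Suc n)
    define j where "j = Suc (rank {y, u}) + n"
    let ?D = "seen c j u - seen c j x"
    have D: "?D \<noteq> {}" using Suc by (auto simp: j_def)
    have mono: "seen c j u \<subseteq> seen c (Suc j) u" by (auto simp: seen_def)
    have "\<exists>a\<in>?D. a \<notin> seen c (Suc j) x"
    \<comment> \<open>Only an edge at \<open>x\<close> can shrink \<open>?D\<close>, and by
      injectivity of \<open>rank\<close> at most one edge has rank \<open>j\<close>.\<close>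
    proof (cases "\<exists>e\<in>E. x \<in> e \<and> rank e = j")
      case False
      have "seen c (Suc j) x \<subseteq> seen c j x"
      proof
        fix a assume "a \<in> seen c (Suc j) x"
        then obtain g where g: "g \<in> E" "x \<in> g" "rank g < Suc j" "a = c g" using seen_D by blast
        then have "rank g < j" using False less_SucE by blast
        then show "a \<in> seen c j x" using g seen_I by blast
      qed
      then show ?thesis using D by blast
    next
      case True
      then obtain e where e: "e \<in> E" "x \<in> e" "rank e = j" by blast
      have sub: "seen c (Suc j) x \<subseteq> insert (c e) (seen c j x)"
      proof
        fix a assume "a \<in> seen c (Suc j) x"
        then obtain g where g: "g \<in> E" "x \<in> g" "rank g < Suc j" "a = c g" using seen_D by blast
        then show "a \<in> insert (c e) (seen c j x)"
          using rank_inj[OF g(1) e(1)] e(3) seen_I by (cases "rank g = j") auto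
      qed
      \<comment> \<open>If \<open>e\<close> contains \<open>u\<close>, its colour is new at
        \<open>u\<close> and thus outside \<open>?D\<close>; any other edge at \<open>x\<close>
        avoids a sole separator because it is guarded.\<close>
      have "?D \<noteq> {c e}"
      proof (cases "u \<in> e")
        case True
        then show ?thesis using admissible_not_seen[OF adm e(1)] e(3) by blast
      next
        case False
        obtain w z where wz: "e = {w, z}" "z \<in> N w" "f w < f z" using edge_cases e(1) by metis
        have "c e \<notin> forbidden c w z" using adm wz by (simp add: admissible_def)
        then have "c e \<notin> guarded c j w z" "c e \<notin> guarded c j z w"
          using wz e(3) by (auto simp: forbidden_def Let_def)
        then show ?thesis
          using wz e(2) False \<open>u \<in> sinks_at x\<close> by (auto simp: guarded_def)
      qed
      then show ?thesis using D sub by blast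
    qed
    then show ?case using mono by (auto simp: j_def)
  qed
  \<comment> \<open>A threshold beyond every rank, where the seen colours at \<open>x\<close> form
    its full palette.\<close>
  let ?k = "Suc (Max (rank ` E))"
  have "seen c (Suc (rank {y, u}) + ?k) x = palette E c x"
  proof -
    have "rank {t, x} < Suc (rank {y, u}) + ?k" if "t \<in> N x" for t
    proof -
      have "rank {t, x} \<le> Max (rank ` E)" using finite_E N_D(1)[OF that] by (intro Max_ge) auto
      then show ?thesis by simp
    qed
    then show ?thesis by (auto simp: seen_def palette_def)
  qed
  then show ?thesis
    using main[of ?k] seen_subset_palette[of c "Suc (rank {y, u}) + ?k" u] by auto
qed

lemma admissible_separates:
  assumes adm: "admissible c" and x: "x \<in> N w" "f x < f w"
  shows "\<not> palette E c w \<subseteq> palette E c x"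
proof (cases "\<exists>t\<in>N w. f x < f t \<and> f t < f w")
  case True
  then obtain v where v: "v \<in> N w" "f x < f v" "f v < f w"
    "\<And>t. t \<in> N w \<Longrightarrow> f x < f t \<Longrightarrow> f t < f w \<Longrightarrow> f v \<le> f t"
    using finite_ex_least[of "{t \<in> N w. f x < f t \<and> f t < f w}" f] finite_N[of w] by auto
  \<comment> \<open>With \<open>v\<close> the next earlier neighbour of \<open>w\<close> after
    \<open>x\<close>, the edge \<open>{v, w}\<close> has \<open>w\<close> as its later endpoint and
    was coloured with \<open>x\<close> as predecessor.\<close>
  have pred: "is_pred w (f v) x"
    using x v unfolding is_pred_def by (meson leD leI less_trans)
  have vw: "w \<in> N v" using v N_sym by blast
  have "c {v, w} \<notin> forbidden c v w" using adm v vw by (simp add: admissible_def)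
  then have "c {v, w} \<notin> blocked c (rank {v, w}) w (f v)" by (auto simp: forbidden_def Let_def)
  moreover have "c {v, w} \<in> palette E c w" using v by (auto simp: palette_def)
  ultimately show ?thesis
    using not_blocked_separates[OF pred] seen_eq_palette[OF vw v(3,2)] by blast
next
  case False
  then have pred: "is_pred w (f w) x" using x by (auto simp: is_pred_def not_less)
  show ?thesis
  proof (cases "sink w")
    case True
    then show ?thesis using sink_separated[OF adm _ _ pred] N_D x by blast
  next
    case False
    obtain z where z: "z \<in> N w" "\<forall>t\<in>N w. f t \<le> f z"
      using finite_ex_greatest[of "N w" f] finite_N x by blast
    have wz: "f w < f z"
      using False z N_D(6) unfolding sink_def by (metis le_less_trans linorder_neqE_nat)
    have "c {w, z} \<notin> forbidden c w z" using adm z wz by (simp add: admissible_def)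
    then have "c {w, z} \<notin> blocked c (rank {w, z}) w (f w)"
      using z(2) by (auto simp: forbidden_def Let_def)
    moreover have "c {w, z} \<in> palette E c w"
      using z by (auto simp: palette_def insert_commute)
    ultimately show ?thesis
      using not_blocked_separates[OF pred] seen_eq_palette[OF z(1) wz x(2)] by blast
  qed
qed

lemma card_palette:
  assumes "proper_edge_colouring E c"
  shows "finite (palette E c v)" "card (palette E c v) = degree E v"
proof -
  have p: "palette E c v = (\<lambda>t. c {t, v}) ` N v" by (auto simp: palette_def)
  have "inj_on (\<lambda>t. c {t, v}) (N v)"
  proof (rule inj_onI)
    fix s t assume st: "s \<in> N v" "t \<in> N v" "c {s, v} = c {t, v}"
    then have "{s, v} = {t, v}"
      using assms N_D(1) unfolding proper_edge_colouring_def
      by (metis disjoint_iff insertCI)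
    then show "s = t" using N_D(5) st by (auto simp: doubleton_eq_iff)
  qed
  then show "card (palette E c v) = degree E v" by (simp add: p card_image degree_def)
  show "finite (palette E c v)" using finite_N by (simp add: p)
qed

lemma admissible_inclusion_free:
  assumes adm: "admissible c"
  shows "inclusion_free E c"
proof -
  have proper: "proper_edge_colouring E c" using admissible_proper[OF adm] .
  have "\<not> palette E c u \<subseteq> palette E c v \<and> \<not> palette E c v \<subseteq> palette E c u"
    if uv: "u \<in> N v" "f u < f v" for u v
  proof -
    have vu: "\<not> palette E c v \<subseteq> palette E c u" using admissible_separates[OF adm uv] .
    \<comment> \<open>The palette of \<open>u\<close> is at least as large as that of
      \<open>v\<close>, so its inclusion would be an equality, contradicting
      \<open>vu\<close>.\<close>
    have "degree E v \<le> degree E u" using degree_decreasing N_D uv by blast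
    then have "palette E c u = palette E c v" if "palette E c u \<subseteq> palette E c v"
      using that card_palette[OF proper] by (intro card_seteq) auto
    then show ?thesis using vu by blast
  qed
  then have "\<forall>u v. {u, v} \<in> E \<longrightarrow>
      \<not> palette E c u \<subseteq> palette E c v \<and> \<not> palette E c v \<subseteq> palette E c u"
    using N_D(6) N_sym by (metis linorder_neqE_nat mem_Collect_eq neighbours_def)
  then show ?thesis using proper by (simp add: inclusion_free_def)
qed

end

section \<open>Construction of the vertex order\<close>

text \<open>Sorting by degree leaves the sinks scattered, and a constant shift moves them to the
  end. A sink is never the earlier endpoint of an edge, so the shift keeps the orientation of every
  edge, and with it the degree condition and the set of sinks.\<close>

lemma ex_vertex_order:
  assumes G: "fin_simple_graph V E"
    and deg: "\<And>v. v \<in> V \<Longrightarrow> 2 \<le> degree E v \<and> degree E v \<le> D"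
  shows "\<exists>f M. ordered_graph V E f M D"
proof -
  interpret fin_simple_graph V E by fact
  obtain h :: "'a \<Rightarrow> nat" and n where h: "inj_on h V" "h ` V = {i. i < n}"
    using finite_imp_inj_to_nat_seg[OF finite_V] by metis
  have hn: "h v < n" if "v \<in> V" for v using h(2) that by blast
  \<comment> \<open>In base \<open>n\<close> the high digit sorts by decreasing degree and
    \<open>h\<close> breaks ties.\<close>
  define g where "g v = (D - degree E v) * n + h v" for v
  \<comment> \<open>Exceeds every value of \<open>g\<close> on \<open>V\<close>, so shifted sinks
    follow all other vertices.\<close>
  define K where "K = (D + 1) * n"
  define f where "f v = (if \<forall>t\<in>neighbours E v. g t < g v then K + g v else g v)" for v
  have gK: "g v < K" if "v \<in> V" for v
  proof -
    have "(D - degree E v) * n \<le> D * n" by (rule mult_le_mono1) simp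
    then show ?thesis using hn[OF that] unfolding g_def K_def distrib_right mult_1 by linarith
  qed
  have gmod: "g v mod n = h v" if "v \<in> V" for v using hn[OF that] by (simp add: g_def)
  have gdiv: "g v div n = D - degree E v" if "v \<in> V" for v using hn[OF that] by (simp add: g_def)
  have ginj: "inj_on g V" using h(1) gmod by (metis inj_on_def)
  have ed: "u \<in> V \<and> v \<in> V \<and> u \<noteq> v \<and> g u \<noteq> g v \<and> u \<in> neighbours E v \<and> v \<in> neighbours E u"
    if "{u, v} \<in> E" for u v
  proof -
    have uv: "u \<in> V" "v \<in> V" "u \<noteq> v" using edges[OF that] by auto
    then have "g u \<noteq> g v" using ginj by (auto dest: inj_onD)
    moreover have "{v, u} \<in> E" using that by (simp add: insert_commute)
    ultimately show ?thesis using uv that by (simp add: neighbours_def)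
  qed
  have fg: "f u < f v \<longleftrightarrow> g u < g v" if "{u, v} \<in> E" for u v
    using ed[OF that] gK[of u] gK[of v] by (auto simp: f_def)
  have sink: "(\<forall>t\<in>neighbours E v. f t < f v) \<longleftrightarrow> (\<forall>t\<in>neighbours E v. g t < g v)" for v
    using fg by (auto simp: neighbours_def)
  have "ordered_graph V E f (2 * K) D"
  proof unfold_locales
    show "inj_on f V"
    proof (rule inj_onI)
      fix u v assume "u \<in> V" "v \<in> V" "f u = f v"
      then have "g u = g v" using gK[of u] gK[of v] by (auto simp: f_def split: if_splits)
      then show "u = v" using ginj \<open>u \<in> V\<close> \<open>v \<in> V\<close> by (auto dest: inj_onD)
    qed
  next
    fix v assume "v \<in> V"
    then show "f v < 2 * K" "2 \<le> degree E v" "degree E v \<le> D"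
      using gK[of v] deg[of v] by (auto simp: f_def)
  next
    fix x w assume xw: "{x, w} \<in> E" "f x < f w"
    then have "g x div n \<le> g w div n" using fg[OF xw(1)] by (intro div_le_mono) simp
    then show "degree E w \<le> degree E x"
      using ed[OF xw(1)] gdiv deg[of x] deg[of w] by auto
  next
    fix v w t
    assume v: "v \<in> V" "\<forall>t\<in>neighbours E v. f t < f v" and wt: "{w, t} \<in> E" "f w < f t"
    have "f v = K + g v" using v(2) sink[of v] by (auto simp: f_def)
    moreover have "f w = g w"
      using ed[OF wt(1)] fg[OF wt(1)] wt(2) by (force simp: f_def)
    ultimately show "f w < f v" using gK[of w] ed[OF wt(1)] by simp
  qed
  then show ?thesis by blast
qed

theorem theorem9:
  fixes V :: "'a set" and E :: "'a set set"
  assumes "fin_simple_graph V E"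
    and "V \<noteq> {}"
    and "min_degree V E \<ge> 2"
  shows "inclusion_chromatic_index E \<le> enat (3 * max_degree V E - 1)"
proof -
  interpret fin_simple_graph V E by fact
  have "2 \<le> degree E v \<and> degree E v \<le> max_degree V E" if "v \<in> V" for v
    using assms(2,3) that finite_V by (simp add: min_degree_def max_degree_def)
  then obtain f M where "ordered_graph V E f M (max_degree V E)"
    using ex_vertex_order[OF assms(1)] by blast
  then interpret ordered_graph V E f M "max_degree V E" .
  obtain c where "admissible c" "c ` E \<subseteq> {..<3 * max_degree V E - 1}"
    using ex_admissible by blast
  then show ?thesis
    unfolding inclusion_chromatic_index_def
    by (intro Inf_lower) (use admissible_inclusion_free in blast)
qed

end
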